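(* Let $0<p_1<p_2<1$. Let $F$ be any cdf, and let $F_1,F_2,\ldots$ be any sequence of (possibly random) cdf's such that $$F_n^{-1}(p) \stackrel{\mathbb{P}}{\to} F^{-1}(p)\ \text{ for } p\in \{p_1,p_2\} \quad\text{and}\quad A_n\sup_{x\in \mathbb{R}} \big| F_n(x) - F(x)\big| =O_{\mathbb{P}}(1)$$ with some normalizing constants $A_n\to \infty$ when $n\to \infty$. Then $$A_n\left( \int_{p_1}^{p_2} F_n^{-1}(u)\, du - \int_{p_1}^{p_2} F^{-1}(u)\, du \right) =A_n\int_{F^{-1}(p_1)}^{F^{-1}(p_2)} \big( F(x)- F_n(x)\big)\, dx +o_{\mathbb{P}}(1)$$ and, therefore, for a random variable $\mathcal{L}(p_1,p_2)$, the convergence-in-distribution statement $$A_n\left( \int_{p_1}^{p_2} F_n^{-1}(u)\, du - \int_{p_1}^{p_2} F^{-1}(u)\, du \right) \stackrel{d}{\to} \mathcal{L}(p_1,p_2)$$ holds if and only if $$A_n\left(\int_{F^{-1}(p_1)}^{F^{-1}(p_2)} F_n(x)\,dx - \int_{F^{-1}(p_1)}^{F^{-1}(p_2)} F(x)\,dx \right) \stackrel{d}{\to} - \mathcal{L}(p_1,p_2) .$$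
   Context: The quantile function of a cdf $F$ is $F^{-1}(u)=\inf\{x\in\mathbb{R}: F(x)\ge u\}$ for $u\in(0,1]$ and $F^{-1}(0)=\lim_{u\downarrow 0}F^{-1}(u)$. The cdf $F$ and the constants $A_n$ are deterministic. The $F_n$ may be random: on an underlying probability space $(\Omega,\mathcal{A},\mathbb{P})$, $F_n:\Omega\times\mathbb{R}\to[0,1]$ is jointly measurable and $F_n(\omega,\cdot)$ is a cdf for almost all $\omega$. No particular sampling design or dependence structure is assumed. $\stackrel{\mathbb{P}}{\to}$ and $\stackrel{d}{\to}$ denote convergence in probability and in distribution; $O_{\mathbb{P}}(1)$ and $o_{\mathbb{P}}(1)$ denote boundedness in probability and convergence to $0$ in probability as $n\to\infty$. *)

theory Defs
  imports "HOL-Probability.Probability"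
begin

definition is_cdf :: "(real \<Rightarrow> real) \<Rightarrow> bool" where
  "is_cdf F \<longleftrightarrow> (\<exists>D. real_distribution D \<and> F = cdf D)"

(* For a cdf F and 0 < u < 1 the set is nonempty and bounded below, so the real
   infimum is the intended one.  The (possibly infinite) values at u = 0 and u = 1
   are not represented: quantile is meant for levels strictly between them. *)
definition quantile :: "(real \<Rightarrow> real) \<Rightarrow> real \<Rightarrow> real" where
  "quantile F u = Inf {x. u \<le> F x}"

(* A jointly measurable map into [0,1] that is a cdf for almost every outcome only. *)
definition random_cdf :: "'a measure \<Rightarrow> ('a \<Rightarrow> real \<Rightarrow> real) \<Rightarrow> bool" where
  "random_cdf M G \<longleftrightarrow>
     (\<lambda>(\<omega>, x). G \<omega> x) \<in> borel_measurable (M \<Otimes>\<^sub>M borel) \<and>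
     (\<forall>\<omega>\<in>space M. \<forall>x. 0 \<le> G \<omega> x \<and> G \<omega> x \<le> 1) \<and>
     (AE \<omega> in M. is_cdf (G \<omega>))"

(* Functionals of a random cdf, such as its quantiles or its supremum distance to F,
   are determined only up to a null set, on whose outcomes G is no cdf; they are
   measurable for the completion of M, but need not be so for M itself. *)
abbreviation random_var :: "'a measure \<Rightarrow> ('a \<Rightarrow> real) \<Rightarrow> bool" where
  "random_var M X \<equiv> X \<in> borel_measurable (completion M)"

definition conv_in_prob :: "'a measure \<Rightarrow> (nat \<Rightarrow> 'a \<Rightarrow> real) \<Rightarrow> ('a \<Rightarrow> real) \<Rightarrow> bool" where
  "conv_in_prob M X Y \<longleftrightarrow>
     (\<forall>n. random_var M (X n)) \<and> random_var M Y \<and>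
     (\<forall>\<epsilon>>0. (\<lambda>n. measure (completion M) {\<omega>\<in>space M. \<bar>X n \<omega> - Y \<omega>\<bar> > \<epsilon>}) \<longlonglongrightarrow> 0)"

definition smallo_in_prob :: "'a measure \<Rightarrow> (nat \<Rightarrow> 'a \<Rightarrow> real) \<Rightarrow> bool" where
  "smallo_in_prob M X \<longleftrightarrow> conv_in_prob M X (\<lambda>_. 0)"

definition bounded_in_prob :: "'a measure \<Rightarrow> (nat \<Rightarrow> 'a \<Rightarrow> real) \<Rightarrow> bool" where
  "bounded_in_prob M X \<longleftrightarrow>
     (\<forall>n. random_var M (X n)) \<and>
     (\<forall>\<epsilon>>0. \<exists>K. \<forall>\<^sub>F n in sequentially.
        measure (completion M) {\<omega>\<in>space M. \<bar>X n \<omega>\<bar> > K} \<le> \<epsilon>)"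

(* The limit variable L may live on a probability space N of its own. *)
definition conv_in_distr ::
    "'a measure \<Rightarrow> (nat \<Rightarrow> 'a \<Rightarrow> real) \<Rightarrow> 'b measure \<Rightarrow> ('b \<Rightarrow> real) \<Rightarrow> bool" where
  "conv_in_distr M X N L \<longleftrightarrow>
     (\<forall>n. random_var M (X n)) \<and> L \<in> borel_measurable N \<and>
     weak_conv_m (\<lambda>n. distr (completion M) borel (X n)) (distr N borel L)"

end

theory Submission
  imports Defs
begin

text \<open>By Fubini, the integral of a quantile function over \<open>(p, q)\<close> depends on the cdf \<open>G\<close> only through
  the truncation of \<open>G\<close> to \<open>[p, q]\<close>.  On \<open>[F\<^sup>-\<^sup>1(p), F\<^sup>-\<^sup>1(q))\<close> the truncation leaves \<open>F\<close> unchanged, and outside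
  it \<open>F\<close> is truncated to a constant; likewise for \<open>G\<close>.  Hence the remainder is an integral that lives
  between the \<open>p\<close>-quantiles and between the \<open>q\<close>-quantiles of \<open>F\<close> and \<open>G\<close>, with an integrand of size at most
  \<open>2 sup \<bar>G - F\<bar>\<close>.  After multiplication by \<open>A\<^sub>n\<close> this is bounded in probability times vanishing in
  probability, and Slutsky's lemma transfers convergence in distribution.\<close>

section \<open>A cdf and its quantile function as a Galois pair\<close>

lemma is_cdf_props:
  assumes "is_cdf G"
  shows is_cdf_quantile_le_iff: "0 < u \<Longrightarrow> u < 1 \<Longrightarrow> quantile G u \<le> x \<longleftrightarrow> u \<le> G x"
    and is_cdf_measurable: "G \<in> borel_measurable borel"
    and is_cdf_nonneg: "0 \<le> G x"
    and is_cdf_le_1: "G x \<le> 1"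
proof -
  obtain D where D: "real_distribution D" and G: "G = cdf D"
    using assms by (auto simp: is_cdf_def)
  interpret cdf_distribution D by (simp add: cdf_distribution.intro D)
  show "0 < u \<Longrightarrow> u < 1 \<Longrightarrow> quantile G u \<le> x \<longleftrightarrow> u \<le> G x"
    \<comment> \<open>Right continuity makes the infimum a minimum. The levels 0 and 1 are excluded
      because there the set may be unbounded below or empty. Every later comparison of arguments
      with quantiles rests on this equivalence.\<close>
    unfolding quantile_def G by (metis pseudoinverse)
  show "G \<in> borel_measurable borel" unfolding G by (rule measurable_C)
  show "0 \<le> G x" "G x \<le> 1" unfolding G by (simp_all add: cdf_nonneg cdf_bounded_prob)
qed

lemma quantile_mono:
  assumes "is_cdf G" "0 < u" "u \<le> v" "v < 1"
  shows "quantile G u \<le> quantile G v"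
  using assms is_cdf_quantile_le_iff[OF assms(1)]
  by (meson dual_order.trans le_less_trans less_le_trans order_refl)

section \<open>Integrals of quantile functions through truncated cdfs\<close>

definition clip :: "real \<Rightarrow> real \<Rightarrow> real \<Rightarrow> real" where
  "clip p q y = max p (min q y)"

lemma clip_measurable [measurable (raw)]:
  "f \<in> borel_measurable M \<Longrightarrow> (\<lambda>z. clip p q (f z)) \<in> borel_measurable M"
  unfolding clip_def by (intro borel_measurable_max borel_measurable_min) auto

lemma abs_clip_diff_le: "\<bar>clip p q y - clip p q z\<bar> \<le> \<bar>y - z\<bar>"
  by (auto simp: clip_def)

text \<open>The layer-cake integrand: \<open>quantile G u\<close> is the integral over \<open>x\<close> of the indicator of
  \<open>G x < u\<close> minus that of \<open>x < 0\<close>, and \<open>level_gap p q G x\<close> is the integral of this difference over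
  \<open>u \<in> (p, q)\<close>.  In the difference of two such integrands the part depending on the sign of \<open>x\<close>
  cancels.\<close>

definition level_gap :: "real \<Rightarrow> real \<Rightarrow> (real \<Rightarrow> real) \<Rightarrow> real \<Rightarrow> real" where
  "level_gap p q G x = (if x < 0 then p else q) - clip p q (G x)"

text \<open>Left of 0 and of the \<open>p\<close>-quantile both terms are \<open>p\<close>; from 0
  and the \<open>q\<close>-quantile on, both are \<open>q\<close>. Thus the difference has compact
  support, although neither term is integrable on its own.\<close>

lemma level_gap_eq_0:
  assumes "is_cdf G" "0 < p" "p < q" "q < 1"
    and "x < min (quantile G p) 0 \<or> max (quantile G q) 0 \<le> x"
  shows "level_gap p q G x = 0"
  using assms is_cdf_quantile_le_iff[OF assms(1), of p x] is_cdf_quantile_le_iff[OF assms(1), of q x]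
  by (auto simp: level_gap_def clip_def max_def min_def split: if_splits)

lemma integrable_level_gap:
  assumes G: "is_cdf G" and pq: "0 < p" "p < q" "q < 1"
  shows "integrable lborel (level_gap p q G)"
proof (rule integrableI_bounded_set)
  let ?S = "{min (quantile G p) 0 .. max (quantile G q) 0}"
  show "?S \<in> sets lborel" by simp
  show "level_gap p q G \<in> borel_measurable lborel"
    unfolding level_gap_def[abs_def] using is_cdf_measurable[OF G] by measurable
  show "emeasure lborel ?S < \<infinity>" by (simp add: emeasure_lborel_Icc_eq)
  show "AE x\<in>?S in lborel. norm (level_gap p q G x) \<le> q - p"
    using pq by (auto simp: level_gap_def clip_def)
  show "AE x in lborel. x \<notin> ?S \<longrightarrow> level_gap p q G x = 0"
    by (intro AE_I2 impI level_gap_eq_0[OF G pq]) auto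
qed

lemma integral_quantile_eq_integral_level_gap:
  assumes G: "is_cdf G" and pq: "0 < p" "p < q" "q < 1"
  shows "(LBINT u=p..q. quantile G u) = (LBINT x. level_gap p q G x)"
proof -
  note [measurable] = is_cdf_measurable[OF G]
  \<comment> \<open>The kernel for Fubini. Subtracting the indicator of \<open>x < 0\<close>
    confines its support to the bounded box \<open>{p..q} \<times> ?S\<close>, and makes the
    integral over \<open>x\<close> a signed length.\<close>
  define h where "h u x = indicator {p<..<q} u * (of_bool (G x < u) - of_bool (x < 0) :: real)" for u x
  let ?S = "{min (quantile G p) 0 .. max (quantile G q) 0}"
  have int: "integrable (lborel \<Otimes>\<^sub>M lborel) (case_prod h)"
  proof (rule integrableI_bounded_set)
    show "{p..q} \<times> ?S \<in> sets (lborel \<Otimes>\<^sub>M lborel)" by measurable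
    show "case_prod h \<in> borel_measurable (lborel \<Otimes>\<^sub>M lborel)"
      unfolding h_def by measurable
    show "emeasure (lborel \<Otimes>\<^sub>M lborel) ({p..q} \<times> ?S) < \<infinity>"
      by (subst lborel.emeasure_pair_measure_Times)
         (auto simp: emeasure_lborel_Icc_eq ennreal_mult_less_top)
    show "AE z\<in>{p..q} \<times> ?S in lborel \<Otimes>\<^sub>M lborel. norm (case_prod h z) \<le> 1"
      by (auto simp: h_def indicator_def split: prod.split)
    \<comment> \<open>For \<open>u\<close> between \<open>p\<close> and \<open>q\<close>, a point
      left of \<open>?S\<close> makes both indicators 1 and a point right of it makes both 0, so
      they cancel.\<close>
    have "h u x = 0" if "(u, x) \<notin> {p..q} \<times> ?S" for u x
    proof (cases "p < u \<and> u < q")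
      case True
      then have "x < min (quantile G p) 0 \<or> max (quantile G q) 0 < x"
        using that by (auto simp: not_le)
      moreover have "quantile G p \<le> x \<longleftrightarrow> p \<le> G x" "quantile G q \<le> x \<longleftrightarrow> q \<le> G x"
        using is_cdf_quantile_le_iff[OF G] pq by auto
      ultimately show ?thesis using True by (auto simp: h_def)
    qed (auto simp: h_def)
    then show "AE z in lborel \<Otimes>\<^sub>M lborel. z \<notin> {p..q} \<times> ?S \<longrightarrow> case_prod h z = 0"
      by (intro AE_I2) (auto split: prod.split)
  qed
  have 1: "(LBINT x. h u x) = indicator {p<..<q} u * quantile G u" for u
  proof (cases "p < u \<and> u < q")
    case True
    let ?Q = "quantile G u"
    have iff: "G x < u \<longleftrightarrow> x < ?Q" for x
      using is_cdf_quantile_le_iff[OF G, of u x] pq True by (auto simp: not_le[symmetric])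
    \<comment> \<open>At most one of the two intervals is nonempty, depending on the sign of
      \<open>?Q\<close>; their signed length is \<open>?Q\<close> in either case.\<close>
    have "h u = (\<lambda>x. indicator {0..<?Q} x - indicator {?Q..<0} x)"
      using True by (auto simp: h_def iff fun_eq_iff indicator_def)
    moreover have "(LBINT x. indicator {0..<?Q} x - indicator {?Q..<0} x :: real) = ?Q"
      by (cases "0 \<le> ?Q") auto
    ultimately show ?thesis using True by simp
  qed (simp add: h_def)
  have 2: "(LBINT u. h u x) = level_gap p q G x" for x
  proof -
    \<comment> \<open>The levels in \<open>(p, q)\<close> that exceed \<open>G x\<close> form the
      interval from the truncated value to \<open>q\<close>. This is where the truncation comes
      from.\<close>
    let ?y = "clip p q (G x)"
    have y: "p \<le> ?y" "?y \<le> q" using pq by (auto simp: clip_def)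
    have "(\<lambda>u. h u x) = (\<lambda>u. indicator {?y<..<q} u - of_bool (x < 0) * indicator {p<..<q} u)"
      by (auto simp: h_def fun_eq_iff indicator_def clip_def)
    moreover have "(LBINT u. indicator {?y<..<q} u - of_bool (x < 0) * indicator {p<..<q} u :: real)
      = (q - ?y) - of_bool (x < 0) * (q - p)"
      using pq y by (subst Bochner_Integration.integral_diff)
         (auto simp:  measure_def intro!: integrable_real_indicator)
    ultimately show ?thesis by (simp add: level_gap_def)
  qed
  have "(LBINT u=p..q. quantile G u) = (LBINT u. LBINT x. h u x)"
    using pq by (simp add: interval_lebesgue_integral_le_eq set_lebesgue_integral_def 1)
  also have "\<dots> = (LBINT x. LBINT u. h u x)"
    using lborel_pair.Fubini_integral[OF int] by simp
  finally show ?thesis by (simp add: 2)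
qed

text \<open>The deterministic core, applied later outcome by outcome. The bound is a product: the
  normalization will be absorbed by the factor \<open>S\<close>, and the quantile displacements
  still tend to 0.\<close>

lemma quantile_integral_remainder:
  assumes G: "is_cdf G" and F: "is_cdf F" and pq: "0 < p" "p < q" "q < 1"
    and S: "\<And>x. \<bar>G x - F x\<bar> \<le> S"
  shows "\<bar>(LBINT u=p..q. quantile G u) - (LBINT u=p..q. quantile F u)
           - (LBINT x=quantile F p..quantile F q. F x - G x)\<bar>
         \<le> 2 * S * (\<bar>quantile G p - quantile F p\<bar> + \<bar>quantile G q - quantile F q\<bar>)"
proof -
  define a b a' b' where ab: "a = quantile F p" "b = quantile F q" "a' = quantile G p" "b' = quantile G q"
  note [measurable] = is_cdf_measurable[OF G] is_cdf_measurable[OF F]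
  have "a \<le> b" using quantile_mono[OF F, of p q] pq by (simp add: ab)
  have S0: "0 \<le> S" using S[of 0] by linarith
  \<comment> \<open>Written with \<open>level_gap\<close> rather than \<open>clip\<close> so that
    each term is integrable; the parts depending on the sign of \<open>x\<close> cancel.\<close>
  define r where "r x = level_gap p q G x - level_gap p q F x - indicator {a<..<b} x * (F x - G x)" for x
  have int3: "integrable lborel (\<lambda>x. indicator {a<..<b} x * (F x - G x))"
    by (rule integrableI_bounded_set[where A="{a<..<b}" and B=S])
       (use S in \<open>auto simp: abs_minus_commute \<open>a \<le> b\<close> indicator_def\<close>)
  note int = integrable_level_gap[OF G pq] integrable_level_gap[OF F pq] int3
  have intr: "integrable lborel r"
    unfolding r_def using int by (intro Bochner_Integration.integrable_diff)
  have eq: "(LBINT u=p..q. quantile G u) - (LBINT u=p..q. quantile F u) - (LBINT x=a..b. F x - G x)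
      = (LBINT x. r x)"
    using int \<open>a \<le> b\<close> unfolding r_def integral_quantile_eq_integral_level_gap[OF G pq]
      integral_quantile_eq_integral_level_gap[OF F pq]
    by (simp add: interval_lebesgue_integral_le_eq set_lebesgue_integral_def)
  let ?I = "{min a a'..max a a'}" and ?J = "{min b b'..max b b'}"
  \<comment> \<open>One \<open>S\<close> pays for the difference of the truncations, the other for
    the subtracted integrand. A sum of indicators suffices as majorant: an overlap of the intervals
    only enlarges it.\<close>
  let ?m = "\<lambda>x. 2 * S * (indicator ?I x + indicator ?J x)"
  have intm: "integrable lborel ?m"
    by (intro integrable_mult_right Bochner_Integration.integrable_add integrable_real_indicator)
       (auto simp: emeasure_lborel_Icc_eq)
  have bound: "norm (r x) \<le> ?m x" for x
  proof -
    have iff: "a \<le> x \<longleftrightarrow> p \<le> F x" "b \<le> x \<longleftrightarrow> q \<le> F x" "a' \<le> x \<longleftrightarrow> p \<le> G x" "b' \<le> x \<longleftrightarrow> q \<le> G x"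
      unfolding ab using is_cdf_quantile_le_iff[OF F] is_cdf_quantile_le_iff[OF G] pq by auto
    have r: "r x = clip p q (F x) - clip p q (G x) - indicator {a<..<b} x * (F x - G x)"
      by (simp add: r_def level_gap_def)
    have "norm (r x) \<le> 2 * S"
      unfolding r using abs_clip_diff_le[of p q "F x" "G x"] S[of x]
      by (auto simp: indicator_def)
    \<comment> \<open>Off \<open>?I\<close> the values \<open>F x\<close> and \<open>G x\<close> lie
      on the same side of \<open>p\<close>, off \<open>?J\<close> on the same side of
      \<open>q\<close>. So both are truncated to the same constant outside \<open>(a, b)\<close>, or
      both are left unchanged inside it. The endpoints \<open>a\<close> and \<open>b\<close> belong
      to \<open>?I\<close> and \<open>?J\<close>.\<close>
    moreover have "r x = 0" if "x \<notin> ?I" "x \<notin> ?J"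
    proof -
      have "(x < a \<and> F x < p \<and> G x < p) \<or> (a < x \<and> p \<le> F x \<and> p \<le> G x)"
        using \<open>x \<notin> ?I\<close> iff(1,3) by (auto simp: min_def max_def split: if_splits)
      moreover have "(b < x \<and> q \<le> F x \<and> q \<le> G x) \<or> (x < b \<and> F x < q \<and> G x < q)"
        using \<open>x \<notin> ?J\<close> iff(2,4) by (auto simp: min_def max_def split: if_splits)
      ultimately show ?thesis
        unfolding r using \<open>a \<le> b\<close> pq by (elim disjE) (simp_all add: clip_def)
    qed
    ultimately show ?thesis using S0
      by (cases "x \<in> ?I"; cases "x \<in> ?J") (auto simp del: atLeastAtMost_iff)
  qed
  have "\<bar>LBINT x. r x\<bar> \<le> (LBINT x. norm (r x))"
    using integral_norm_bound[of lborel r] by simp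
  also have "\<dots> \<le> (LBINT x. ?m x)"
    by (intro integral_mono integrable_norm intr intm bound)
  also have "\<dots> = 2 * S * (LBINT x. indicator ?I x + indicator ?J x)"
    by (rule integral_mult_right_zero)
  also have "(LBINT x. indicator ?I x + indicator ?J x :: real) = \<bar>a' - a\<bar> + \<bar>b' - b\<bar>"
    by (subst Bochner_Integration.integral_add)
       (auto simp: emeasure_lborel_Icc_eq min_def max_def)
  finally show ?thesis unfolding eq[symmetric] by (simp add: ab)
qed

section \<open>Convergence in distribution: Slutsky's lemma and change of sign\<close>

lemma conv_in_distr_Slutsky:
  assumes M: "prob_space M" and N: "prob_space N"
    and diff: "smallo_in_prob M (\<lambda>n \<omega>. X n \<omega> - Y n \<omega>)"
    and Y: "\<And>n. random_var M (Y n)"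
    and conv: "conv_in_distr M X N L"
  shows "conv_in_distr M Y N L"
proof -
  interpret C: prob_space "completion M" by (rule prob_space.prob_space_completion[OF M])
  interpret N: prob_space N by (rule N)
  have X: "X n \<in> borel_measurable (completion M)" for n using conv by (simp add: conv_in_distr_def)
  have L: "L \<in> borel_measurable N" using conv by (simp add: conv_in_distr_def)
  note [measurable] = X Y L
  have wX: "weak_conv_m (\<lambda>n. distr (completion M) borel (X n)) (distr N borel L)"
    using conv by (simp add: conv_in_distr_def)
  have "weak_conv_m (\<lambda>n. distr (completion M) borel (Y n)) (distr N borel L)"
  proof (rule integral_cts_step_conv_imp_weak_conv)
    fix x y :: real assume xy: "x < y"
    \<comment> \<open>Continuous steps determine weak convergence and are uniformly continuous, so
      closeness of \<open>X n\<close> and \<open>Y n\<close> carries over to the test function with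
      one modulus for all outcomes.\<close>
    let ?f = "cts_step x y"
    have unif: "uniformly_continuous_on UNIV ?f" using xy by (rule cts_step_uniformly_continuous)
    then have cont: "continuous_on UNIV ?f" by (rule uniformly_continuous_imp_continuous)
    have [measurable]: "?f \<in> borel_measurable borel" using cont by (rule borel_measurable_continuous_onI)
    have f01: "0 \<le> ?f z" "?f z \<le> 1" for z using xy by (auto simp: cts_step_def)
    have intf: "integrable (completion M) (\<lambda>\<omega>. ?f (Z \<omega>))"
      if [measurable]: "Z \<in> borel_measurable (completion M)" for Z
      by (rule C.integrable_const_bound[of _ 1]) (auto simp: f01)
    have cX: "(\<lambda>n. LINT \<omega>|completion M. ?f (X n \<omega>)) \<longlonglongrightarrow> (LINT z|N. ?f (L z))"
      using weak_conv_imp_integral_bdd_continuous_conv[OF _ _ wX, of ?f 1] cont f01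
      by (auto simp: integral_distr C.real_distribution_distr N.real_distribution_distr
          continuous_on_eq_continuous_at)
    have "(\<lambda>n. (LINT \<omega>|completion M. ?f (Y n \<omega>)) - (LINT \<omega>|completion M. ?f (X n \<omega>))) \<longlonglongrightarrow> 0"
    proof (rule LIMSEQ_I)
      fix e :: real assume e: "0 < e"
      obtain d where d: "d > 0" "\<And>s t. dist s t < d \<Longrightarrow> dist (?f s) (?f t) < e / 2"
        using unif e unfolding uniformly_continuous_on_def by (metis UNIV_I half_gt_zero)
      \<comment> \<open>Off \<open>E n\<close> the distance is at most \<open>d / 2\<close>, hence
        strictly below \<open>d\<close>, and the test values differ by less than
        \<open>e / 2\<close>. On \<open>E n\<close> they differ by at most 1, which costs the
        probability of \<open>E n\<close>.\<close>
      define E where "E n = {\<omega>\<in>space M. \<bar>X n \<omega> - Y n \<omega>\<bar> > d / 2}" for n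
      have E: "E n \<in> sets (completion M)" for n
      proof -
        have "{\<omega>\<in>space (completion M). \<bar>X n \<omega> - Y n \<omega>\<bar> > d / 2} \<in> sets (completion M)"
          by measurable
        then show ?thesis by (simp add: E_def)
      qed
      have intE: "integrable (completion M) (indicat_real (E n))" for n
        by (intro integrable_real_indicator E)
           (simp add: less_top[symmetric] del: emeasure_completion)
      have "(\<lambda>n. measure (completion M) (E n)) \<longlonglongrightarrow> 0"
        using diff half_gt_zero[OF d(1)] unfolding smallo_in_prob_def conv_in_prob_def diff_zero E_def
        by blast
      then have "\<forall>\<^sub>F n in sequentially. measure (completion M) (E n) < e / 2"
        using e by (intro order_tendstoD) auto
      then obtain n0 where n0: "\<And>n. n \<ge> n0 \<Longrightarrow> measure (completion M) (E n) < e / 2"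
        by (auto simp: eventually_sequentially)
      show "\<exists>n0. \<forall>n\<ge>n0. norm ((LINT \<omega>|completion M. ?f (Y n \<omega>))
          - (LINT \<omega>|completion M. ?f (X n \<omega>)) - 0) < e"
      proof (intro exI allI impI)
        fix n assume "n0 \<le> n"
        have "norm ((LINT \<omega>|completion M. ?f (Y n \<omega>)) - (LINT \<omega>|completion M. ?f (X n \<omega>)) - 0)
            = \<bar>LINT \<omega>|completion M. ?f (Y n \<omega>) - ?f (X n \<omega>)\<bar>"
          by (simp add: intf X Y)
        also have "\<dots> \<le> (LINT \<omega>|completion M. norm (?f (Y n \<omega>) - ?f (X n \<omega>)))"
          using integral_norm_bound[of "completion M" "\<lambda>\<omega>. ?f (Y n \<omega>) - ?f (X n \<omega>)"] by simp
        also have "\<dots> \<le> (LINT \<omega>|completion M. e / 2 + indicator (E n) \<omega>)"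
        proof (rule integral_mono)
          fix \<omega> assume "\<omega> \<in> space (completion M)"
          then show "norm (?f (Y n \<omega>) - ?f (X n \<omega>)) \<le> e / 2 + indicator (E n) \<omega>"
            using d(2)[of "X n \<omega>" "Y n \<omega>"] f01[of "Y n \<omega>"] f01[of "X n \<omega>"] d(1) e
            by (cases "\<omega> \<in> E n") (auto simp: E_def dist_real_def abs_minus_commute)
        qed (auto intro!: Bochner_Integration.integrable_diff Bochner_Integration.integrable_add
            integrable_norm intf intE X Y)
        also have "\<dots> = e / 2 + measure (completion M) (E n)"
          using sets.sets_into_space[OF E[of n]] C.prob_space intE[of n]
          by (subst Bochner_Integration.integral_add) (auto simp: Int_absorb2)
        also have "\<dots> < e" using n0[OF \<open>n0 \<le> n\<close>] by linarith
        finally show "norm ((LINT \<omega>|completion M. ?f (Y n \<omega>))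
          - (LINT \<omega>|completion M. ?f (X n \<omega>)) - 0) < e" .
      qed
    qed
    from tendsto_add[OF this cX]
    show "(\<lambda>n. integral\<^sup>L (distr (completion M) borel (Y n)) ?f) \<longlonglongrightarrow> integral\<^sup>L (distr N borel L) ?f"
      by (simp add: integral_distr)
  qed auto
  then show ?thesis using Y L by (simp add: conv_in_distr_def)
qed

text \<open>Continuous mapping for negation: test with the reflected function.\<close>

lemma conv_in_distr_uminus:
  assumes M: "prob_space M" and N: "prob_space N" and conv: "conv_in_distr M X N L"
  shows "conv_in_distr M (\<lambda>n \<omega>. - X n \<omega>) N (\<lambda>z. - L z)"
proof -
  interpret C: prob_space "completion M" by (rule prob_space.prob_space_completion[OF M])
  interpret N: prob_space N by (rule N)
  have X: "X n \<in> borel_measurable (completion M)" for n using conv by (simp add: conv_in_distr_def)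
  have L: "L \<in> borel_measurable N" using conv by (simp add: conv_in_distr_def)
  note [measurable] = X L
  have wX: "weak_conv_m (\<lambda>n. distr (completion M) borel (X n)) (distr N borel L)"
    using conv by (simp add: conv_in_distr_def)
  have "weak_conv_m (\<lambda>n. distr (completion M) borel (\<lambda>\<omega>. - X n \<omega>)) (distr N borel (\<lambda>z. - L z))"
  proof (rule integral_bdd_continuous_conv_imp_weak_conv)
    fix f :: "real \<Rightarrow> real" assume cont: "\<And>x. isCont f x" and bd: "\<And>x. \<bar>f x\<bar> \<le> 1"
    have [measurable]: "f \<in> borel_measurable borel"
      using cont by (intro borel_measurable_continuous_onI continuous_at_imp_continuous_on) auto
    have "isCont (\<lambda>x. f (- x)) x" for x
      by (intro continuous_at_compose[unfolded o_def, of _ uminus f] continuous_intros cont)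
    then have "(\<lambda>n. integral\<^sup>L (distr (completion M) borel (X n)) (\<lambda>x. f (- x)))
        \<longlonglongrightarrow> integral\<^sup>L (distr N borel L) (\<lambda>x. f (- x))"
      using bd by (intro weak_conv_imp_integral_bdd_continuous_conv[OF _ _ wX, of _ 1])
        (auto simp: C.real_distribution_distr N.real_distribution_distr)
    then show "(\<lambda>n. integral\<^sup>L (distr (completion M) borel (\<lambda>\<omega>. - X n \<omega>)) f)
        \<longlonglongrightarrow> integral\<^sup>L (distr N borel (\<lambda>z. - L z)) f"
      by (simp add: integral_distr)
  qed auto
  then show ?thesis using X L by (simp add: conv_in_distr_def)
qed

section \<open>Measurability up to null sets, and products of bounded and vanishing
  sequences\<close>

lemma random_var_AE_cong:
  assumes f: "f \<in> borel_measurable M" and eq: "AE \<omega> in M. f \<omega> = g \<omega>"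
  shows "random_var M g"
proof (rule borel_measurableI)
  fix S :: "real set" assume "open S"
  \<comment> \<open>The two preimages differ by a null set only, and the completion absorbs such a
    difference.\<close>
  have "AE \<omega> in completion M. \<omega> \<in> f -` S \<inter> space M \<longleftrightarrow> \<omega> \<in> g -` S \<inter> space M"
    using AE_completion[OF eq] by eventually_elim auto
  moreover have "f -` S \<inter> space M \<in> sets (completion M)"
    using f \<open>open S\<close> by (intro sets_completionI_sets measurable_sets[OF f]) auto
  ultimately show "g -` S \<inter> space (completion M) \<in> sets (completion M)"
    unfolding space_completion by (rule completion.in_sets_AE) simp
qed

lemma conv_in_probD:
  assumes "conv_in_prob M X Y"
  shows "random_var M (X n)" and "random_var M Y"
    and "0 < \<epsilon> \<Longrightarrow> (\<lambda>n. measure (completion M) {\<omega>\<in>space M. \<bar>X n \<omega> - Y \<omega>\<bar> > \<epsilon>}) \<longlonglongrightarrow> 0"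
  using assms unfolding conv_in_prob_def by blast+

lemma smallo_in_prob_dominated:
  assumes M: "prob_space M" and R: "\<And>n. random_var M (R n)" and c: "0 < c"
    and B: "bounded_in_prob M B" and X: "conv_in_prob M X X'" and Y: "conv_in_prob M Y Y'"
    and le: "\<And>n. AE \<omega> in M. \<bar>R n \<omega>\<bar> \<le> c * \<bar>B n \<omega>\<bar> * (\<bar>X n \<omega> - X' \<omega>\<bar> + \<bar>Y n \<omega> - Y' \<omega>\<bar>)"
  shows "smallo_in_prob M R"
  unfolding smallo_in_prob_def conv_in_prob_def diff_zero
proof (intro conjI allI impI R)
  fix \<epsilon> :: real assume \<epsilon>: "0 < \<epsilon>"
  interpret C: prob_space "completion M" by (rule prob_space.prob_space_completion[OF M])
  note [measurable] = B[unfolded bounded_in_prob_def, THEN conjunct1, rule_format]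
    conv_in_probD(1,2)[OF X] conv_in_probD(1,2)[OF Y]
  let ?P = "measure (completion M)"
  show "(\<lambda>n. ?P {\<omega>\<in>space M. \<bar>R n \<omega>\<bar> > \<epsilon>}) \<longlonglongrightarrow> 0"
  proof (rule order_tendstoI)
    fix e :: real assume "e < 0"
    then show "\<forall>\<^sub>F n in sequentially. e < ?P {\<omega>\<in>space M. \<bar>R n \<omega>\<bar> > \<epsilon>}"
      by (intro always_eventually allI less_le_trans[OF _ measure_nonneg])
  next
    fix e :: real assume e: "0 < e"
    \<comment> \<open>Three exceptional events of probability at most \<open>e / 4\<close> leave the
      total strictly below \<open>e\<close>.\<close>
    obtain K0 where K0: "\<forall>\<^sub>F n in sequentially. ?P {\<omega>\<in>space M. \<bar>B n \<omega>\<bar> > K0} \<le> e / 4"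
      using B[unfolded bounded_in_prob_def, THEN conjunct2, rule_format, of "e / 4"]
        divide_pos_pos[OF e zero_less_numeral] by blast
    \<comment> \<open>\<open>K\<close> is made positive so that it can be divided by;
      \<open>d\<close> is then chosen to give \<open>c * K * (d + d) = \<epsilon>\<close>.\<close>
    define K where "K = max K0 1"
    define d where "d = \<epsilon> / (2 * c * K)"
    have K: "0 < K" "K0 \<le> K" and d: "0 < d" using \<epsilon> c by (auto simp: K_def d_def)
    let ?EB = "\<lambda>n. {\<omega>\<in>space (completion M). \<bar>B n \<omega>\<bar> > K0}"
    let ?EX = "\<lambda>n. {\<omega>\<in>space (completion M). \<bar>X n \<omega> - X' \<omega>\<bar> > d}"
    let ?EY = "\<lambda>n. {\<omega>\<in>space (completion M). \<bar>Y n \<omega> - Y' \<omega>\<bar> > d}"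
    have sets: "?EB n \<in> sets (completion M)" "?EX n \<in> sets (completion M)"
      "?EY n \<in> sets (completion M)" for n by measurable
    have e4: "0 < e / 4" using e by simp
    have EX: "\<forall>\<^sub>F n in sequentially. ?P (?EX n) < e / 4"
      unfolding space_completion by (rule order_tendstoD(2)[OF conv_in_probD(3)[OF X d] e4])
    have EY: "\<forall>\<^sub>F n in sequentially. ?P (?EY n) < e / 4"
      unfolding space_completion by (rule order_tendstoD(2)[OF conv_in_probD(3)[OF Y d] e4])
    have sub: "?P {\<omega>\<in>space M. \<bar>R n \<omega>\<bar> > \<epsilon>} \<le> ?P (?EB n) + ?P (?EX n) + ?P (?EY n)" for n
    proof -
      \<comment> \<open>The domination holds almost surely, so the inclusion of events does
        too.\<close>
      have "AE \<omega> in completion M. \<omega> \<in> {\<omega>\<in>space M. \<bar>R n \<omega>\<bar> > \<epsilon>} \<longrightarrow> \<omega> \<in> ?EB n \<union> ?EX n \<union> ?EY n"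
        using AE_completion[OF le[of n]]
      proof eventually_elim
        case (elim \<omega>)
        have "\<bar>R n \<omega>\<bar> \<le> \<epsilon>"
          if "\<bar>B n \<omega>\<bar> \<le> K0" "\<bar>X n \<omega> - X' \<omega>\<bar> \<le> d" "\<bar>Y n \<omega> - Y' \<omega>\<bar> \<le> d"
        proof -
          note elim
          also have "c * \<bar>B n \<omega>\<bar> * (\<bar>X n \<omega> - X' \<omega>\<bar> + \<bar>Y n \<omega> - Y' \<omega>\<bar>) \<le> c * K * (d + d)"
            using that K c by (intro mult_mono add_mono) auto
          also have "\<dots> = \<epsilon>" using K c by (simp add: d_def)
          finally show ?thesis .
        qed
        then show ?case by (auto simp: not_less[symmetric])
      qed
      then have "?P {\<omega>\<in>space M. \<bar>R n \<omega>\<bar> > \<epsilon>} \<le> ?P (?EB n \<union> ?EX n \<union> ?EY n)"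
        using sets[of n] by (intro C.finite_measure_mono_AE sets.Un)
      also have "\<dots> \<le> ?P (?EB n \<union> ?EX n) + ?P (?EY n)"
        using sets[of n] by (intro measure_Un_le sets.Un)
      also have "\<dots> \<le> ?P (?EB n) + ?P (?EX n) + ?P (?EY n)"
        using sets[of n] by (intro add_right_mono measure_Un_le)
      finally show ?thesis .
    qed
    show "\<forall>\<^sub>F n in sequentially. ?P {\<omega>\<in>space M. \<bar>R n \<omega>\<bar> > \<epsilon>} < e"
      using K0 EX EY
    proof eventually_elim
      case (elim n)
      then show ?case using sub[of n] e unfolding space_completion by linarith
    qed
  qed
qed simp

section \<open>The normalized remainder and the equivalence of the limits\<close>

theorem corollary6p3:
  fixes M :: "'a measure" and N :: "'b measure"
    and p1 p2 :: real
    and F :: "real \<Rightarrow> real"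
    and Fn :: "nat \<Rightarrow> 'a \<Rightarrow> real \<Rightarrow> real"
    and A :: "nat \<Rightarrow> real"
    and L :: "'b \<Rightarrow> real"
  assumes "prob_space M"
    and "0 < p1" "p1 < p2" "p2 < 1"
    and "is_cdf F"
    and "\<And>n. random_cdf M (Fn n)"
    and "\<And>p. p \<in> {p1, p2} \<Longrightarrow>
           conv_in_prob M (\<lambda>n \<omega>. quantile (Fn n \<omega>) p) (\<lambda>_. quantile F p)"
    and "filterlim A at_top sequentially"
    and "bounded_in_prob M (\<lambda>n \<omega>. A n * (SUP x. \<bar>Fn n \<omega> x - F x\<bar>))"
    and "prob_space N" "L \<in> borel_measurable N"
  shows "smallo_in_prob M (\<lambda>n \<omega>.
           A n * ((LBINT u=p1..p2. quantile (Fn n \<omega>) u) - (LBINT u=p1..p2. quantile F u))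
           - A n * (LBINT x=quantile F p1..quantile F p2. F x - Fn n \<omega> x))
       \<and> (conv_in_distr M (\<lambda>n \<omega>.
             A n * ((LBINT u=p1..p2. quantile (Fn n \<omega>) u) - (LBINT u=p1..p2. quantile F u)))
             N L
          \<longleftrightarrow>
          conv_in_distr M (\<lambda>n \<omega>.
             A n * ((LBINT x=quantile F p1..quantile F p2. Fn n \<omega> x)
                    - (LBINT x=quantile F p1..quantile F p2. F x)))
             N (\<lambda>z. - L z))"
proof -
  note F = \<open>is_cdf F\<close> and pq = assms(2-4)
  define a b where "a = quantile F p1" and "b = quantile F p2"
  define X where "X n \<omega> =
    A n * ((LBINT u=p1..p2. quantile (Fn n \<omega>) u) - (LBINT u=p1..p2. quantile F u))" for n \<omega>
  define Y where "Y n \<omega> = A n * (LBINT x=a..b. F x - Fn n \<omega> x)" for n \<omega>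
  define Z where "Z n \<omega> = A n * ((LBINT x=a..b. Fn n \<omega> x) - (LBINT x=a..b. F x))" for n \<omega>
  have "a \<le> b" using quantile_mono[OF F, of p1 p2] pq by (simp add: a_def b_def)
  note [measurable] = is_cdf_measurable[OF F]
  \<comment> \<open>In this form joint measurability makes integrals over \<open>x\<close>
    measurable functions of the outcome.\<close>
  have Fn_meas[measurable]: "(\<lambda>z. Fn n (fst z) (snd z)) \<in> borel_measurable (M \<Otimes>\<^sub>M lborel)" for n
    using assms(6)[of n] unfolding random_cdf_def split_beta'
    by (simp cong: measurable_cong_sets sets_pair_measure_cong)
  have Fn_cdf: "AE \<omega> in M. is_cdf (Fn n \<omega>)" for n
    using assms(6)[of n] by (simp add: random_cdf_def)

  \<comment> \<open>The integral of \<open>level_gap\<close> is measurable for \<open>M\<close>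
    itself and equals the quantile integral wherever \<open>Fn n\<close> is a cdf, hence almost
    everywhere.\<close>
  have X: "random_var M (X n)" for n
  proof (rule random_var_AE_cong)
    show "(\<lambda>\<omega>. A n * ((LBINT x. level_gap p1 p2 (Fn n \<omega>) x) - (LBINT u=p1..p2. quantile F u)))
        \<in> borel_measurable M"
      unfolding level_gap_def by measurable
    show "AE \<omega> in M. A n * ((LBINT x. level_gap p1 p2 (Fn n \<omega>) x)
        - (LBINT u=p1..p2. quantile F u)) = X n \<omega>"
      using Fn_cdf[of n] by eventually_elim
        (simp add: X_def integral_quantile_eq_integral_level_gap[OF _ pq])
  qed
  have Y: "random_var M (Y n)" for n
    unfolding Y_def interval_lebesgue_integral_le_eq[OF ereal_less_eq(3)[THEN iffD2, OF \<open>a \<le> b\<close>]]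
      set_lebesgue_integral_def
    by (rule measurable_completion) measurable
  have Z: "random_var M (Z n)" for n
    unfolding Z_def interval_lebesgue_integral_le_eq[OF ereal_less_eq(3)[THEN iffD2, OF \<open>a \<le> b\<close>]]
      set_lebesgue_integral_def
    by (rule measurable_completion) measurable

  have int_ab: "interval_lebesgue_integrable lborel a b G" if G: "is_cdf G" for G
  proof -
    note [measurable] = is_cdf_measurable[OF G]
    show ?thesis
      using \<open>a \<le> b\<close> unfolding interval_lebesgue_integrable_def set_integrable_def
      by (simp del: real_scaleR_def, intro integrableI_bounded_set_indicator[where B=1])
         (simp_all add: is_cdf_nonneg[OF G] is_cdf_le_1[OF G])
  qed
  \<comment> \<open>The sign identity is obtained on the same almost sure event as the estimate, so
    the two are carried together.\<close>
  have bound: "AE \<omega> in M. Y n \<omega> = - Z n \<omega> \<and> \<bar>X n \<omega> - Y n \<omega>\<bar>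
      \<le> 2 * \<bar>A n * (SUP x. \<bar>Fn n \<omega> x - F x\<bar>)\<bar>
        * (\<bar>quantile (Fn n \<omega>) p1 - a\<bar> + \<bar>quantile (Fn n \<omega>) p2 - b\<bar>)" for n
    using Fn_cdf[of n]
  proof eventually_elim
    case (elim \<omega>)
    let ?S = "SUP x. \<bar>Fn n \<omega> x - F x\<bar>"
    have "\<bar>Fn n \<omega> x - F x\<bar> \<le> 1" for x
      using is_cdf_nonneg[OF elim, of x] is_cdf_le_1[OF elim, of x] is_cdf_nonneg[OF F, of x]
        is_cdf_le_1[OF F, of x] by linarith
    \<comment> \<open>The bound 1 makes the family bounded above, so that the real supremum is a
      genuine upper bound.\<close>
    then have S: "\<bar>Fn n \<omega> x - F x\<bar> \<le> ?S" for x
      by (intro cSUP_upper bdd_aboveI2) auto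
    then have S0: "0 \<le> ?S" using abs_ge_zero order_trans by blast
    have "X n \<omega> - Y n \<omega> = A n * ((LBINT u=p1..p2. quantile (Fn n \<omega>) u) - (LBINT u=p1..p2. quantile F u)
        - (LBINT x=a..b. F x - Fn n \<omega> x))"
      by (simp add: X_def Y_def algebra_simps)
    also have "\<bar>\<dots>\<bar> \<le> \<bar>A n\<bar> * (2 * ?S * (\<bar>quantile (Fn n \<omega>) p1 - a\<bar> + \<bar>quantile (Fn n \<omega>) p2 - b\<bar>))"
      unfolding abs_mult a_def b_def
      by (intro mult_left_mono quantile_integral_remainder[OF elim F pq S]) auto
    finally have "\<bar>X n \<omega> - Y n \<omega>\<bar>
      \<le> 2 * \<bar>A n * ?S\<bar> * (\<bar>quantile (Fn n \<omega>) p1 - a\<bar> + \<bar>quantile (Fn n \<omega>) p2 - b\<bar>)"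
      using S0 by (simp add: abs_mult ac_simps)
    moreover have "Y n \<omega> = - Z n \<omega>"
      unfolding Y_def Z_def interval_lebesgue_integral_diff(2)[OF int_ab[OF F] int_ab[OF elim]]
      by (simp add: algebra_simps)
    ultimately show ?case by blast
  qed
  \<comment> \<open>Stated for a general \<open>W\<close> because the same domination serves three
    sequences: \<open>X - Y\<close>, \<open>X + Z\<close> and its negative, the last two through
    \<open>Y = - Z\<close>.\<close>
  have small: "smallo_in_prob M W"
    if "\<And>n. random_var M (W n)" "\<And>n. AE \<omega> in M. Y n \<omega> = - Z n \<omega> \<longrightarrow> \<bar>W n \<omega>\<bar> = \<bar>X n \<omega> - Y n \<omega>\<bar>" for W
    using assms(1) that(1) _ assms(9) assms(7)[of p1] assms(7)[of p2]
  proof (rule smallo_in_prob_dominated)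
    show "AE \<omega> in M. \<bar>W n \<omega>\<bar> \<le> 2 * \<bar>A n * (SUP x. \<bar>Fn n \<omega> x - F x\<bar>)\<bar> *
        (\<bar>quantile (Fn n \<omega>) p1 - quantile F p1\<bar> + \<bar>quantile (Fn n \<omega>) p2 - quantile F p2\<bar>)" for n
      using that(2)[of n] bound[of n] by eventually_elim (auto simp: a_def b_def)
  qed auto
  have "smallo_in_prob M (\<lambda>n \<omega>. X n \<omega> - Y n \<omega>)"
    using X Y by (intro small borel_measurable_diff) auto
  moreover have "conv_in_distr M X N L \<longleftrightarrow> conv_in_distr M Z N (\<lambda>z. - L z)"
  proof
    \<comment> \<open>\<open>- Z\<close> is the intermediate sequence: Slutsky's lemma exchanges it
      with \<open>X\<close>, negation exchanges it with \<open>Z\<close>. Each direction needs the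
      difference in its own order.\<close>
    have mZ: "random_var M (\<lambda>\<omega>. - Z n \<omega>)" for n using Z by (rule borel_measurable_uminus)
    have XZ: "smallo_in_prob M (\<lambda>n \<omega>. X n \<omega> - - Z n \<omega>)"
      using X mZ by (intro small borel_measurable_diff) auto
    have ZX: "smallo_in_prob M (\<lambda>n \<omega>. - Z n \<omega> - X n \<omega>)"
      using X mZ by (intro small borel_measurable_diff) (auto simp: abs_minus_commute)
    { assume "conv_in_distr M X N L"
      from conv_in_distr_uminus[OF assms(1,10) conv_in_distr_Slutsky[OF assms(1,10) XZ mZ this]]
      show "conv_in_distr M Z N (\<lambda>z. - L z)" by simp }
    { assume "conv_in_distr M Z N (\<lambda>z. - L z)"
      from conv_in_distr_uminus[OF assms(1,10) this]
      have "conv_in_distr M (\<lambda>n \<omega>. - Z n \<omega>) N L" by simp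
      from conv_in_distr_Slutsky[OF assms(1,10) ZX X this] show "conv_in_distr M X N L" . }
  qed
  ultimately show ?thesis unfolding X_def Y_def Z_def a_def b_def by blast
qed

end
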